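(* Let $\gamma>0$, $c>0$, let $M=\mathbb{R}^3\setminus\{0\}$ with flat metric and conformal Killing vector field $\tau=r\frac{\partial}{\partial r}$ (so $\alpha=1$), let $\lambda=\imath\lambda_p$ with $\lambda_p$ real and nonzero, and let \[\beta=-\frac1{c^2(1-\frac\gamma r)}\] (the Schwarzschild $\beta$). Then for $\omega\in\mathbb{R}$ the time part $\Delta_0$ of the associated noncommutative wave operator obeys \[\Delta_0e^{\imath\omega t}=\frac1{c^2}D(\omega,r)e^{\imath\omega t},\] where \[D(\omega,r)=\frac1{\lambda_p^2}\left(\sinh(\omega\lambda_p)+e^{-\omega\lambda_p}\Big(1-\frac\gamma r\Big)\Big(1-e^{\omega\lambda_p}-\frac\gamma r\ln\Big(\frac{e^{\omega\lambda_p}r-\gamma}{r-\gamma}\Big)\Big)\right)\] has limits \[\lim_{\lambda_p\to0}D(\omega,r)=\frac{\omega^2}{2(1-\frac\gamma r)},\quad\lim_{r\to\infty}D(\omega,r)=\frac{\cosh(\omega\lambda_p)-1}{\lambda_p^2},\quad\lim_{r\to\gamma}D(\omega,r)=\frac{\sinh(\omega\lambda_p)}{\lambda_p^2}.\]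
   Context: The algebra is generated by functions on $\mathbb{R}^3\setminus\{0\}$ (here with $\beta$ smooth, e.g. on the region $r>\gamma$) and $t$, with $[f,t]=\lambda\,r\frac{\partial f}{\partial r}$. Elements are written in normal ordered form, functions on space to the left and functions of $t$ to the right. The operator $\Delta_0$ is the left-linear operator over functions on space determined by \[\Delta_0t^n=\sum_{i=0}^{n-1}(\partial_0t^{n-1-i})\,\beta\,(t+\lambda)^i,\qquad\partial_0g(t)=\frac{g(t)-g(t-\lambda)}\lambda\] (products in the algebra, then normal ordered). Equivalently, $\mathrm d(t^n)=(\partial_0t^n)\mathrm dt+\lambda(\Delta_0t^n)\theta'$ in the differential calculus with relations $[\mathrm dt,t]=\beta\lambda\theta'-\lambda\,\mathrm dt$, $[\theta',t]=\lambda\theta'$, $[\theta',f]=0$, $[f,\mathrm dt]=\lambda\,\mathrm df$ for functions $f$ on space. $\Delta_0$ is extended to $e^{\imath\omega t}=\sum_n\frac{(\imath\omega)^n}{n!}t^n$ termwise. $\Delta_0$ depends linearly on $\beta$. The limits are taken through values for which the logarithm in $D(\omega,r)$ has positive argument (e.g. for $\omega\lambda_p>0$, $r\to\gamma$ from above).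
   Formalization: The termwise series for Δ₀e^{iωt} diverges when |ωλ_p|>|ln(r/γ)|; the identity is stated with literal convergence for |ωλ_p|<|ln(r/γ)|, and by analytic continuation in ω from 0 wherever r≠γ and the logarithm in D has positive argument. *)

theory Defs
  imports "HOL-Complex_Analysis.Complex_Analysis" "HOL-Library.Function_Algebras"
begin

type_synonym spacefun = "real^3 \<Rightarrow> complex"

(* The vector field r d/dr, which is tau(x) = x in Cartesian coordinates. *)
definition euler :: "spacefun \<Rightarrow> spacefun" where
  "euler f x = frechet_derivative f (at x) x"

(* An element f_0 + f_1 t + ... + f_n t^n of the algebra, in normal ordered form (functions on
   space to the left, powers of t to the right), is the polynomial with coefficients f_i, where
   the ring structure on functions is the pointwise one.  Left multiplication by a function is
   smult, but the library product of polynomials is NOT the product of the algebra; that is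
   nprod below.  All operations on functions are local on space, so they may be applied to
   functions that are smooth only on an open region and are then meaningful at the points of
   that region. *)

(* t f = f t - lam * euler f, from the relation [f, t] = lam * euler f *)
definition tmul :: "complex \<Rightarrow> spacefun poly \<Rightarrow> spacefun poly" where
  "tmul lam B = pCons 0 B - smult (\<lambda>_. lam) (map_poly euler B)"

definition nprod :: "complex \<Rightarrow> spacefun poly \<Rightarrow> spacefun poly \<Rightarrow> spacefun poly" where
  "nprod lam A B = (\<Sum>n\<le>degree A. smult (poly.coeff A n) ((tmul lam ^^ n) B))"

definition npow :: "complex \<Rightarrow> spacefun poly \<Rightarrow> nat \<Rightarrow> spacefun poly" where
  "npow lam A n = (nprod lam A ^^ n) 1"

abbreviation tgen :: "spacefun poly" where
  "tgen \<equiv> [:0, 1:]"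

lemma euler_const: "euler (\<lambda>_. a) = (\<lambda>_. 0)"
  by (simp add: euler_def fun_eq_iff frechet_derivative_const)

lemma nprod_commutator:
  "nprod lam [:f:] tgen - nprod lam tgen [:f:] = [:\<lambda>x. lam * euler f x:]"
proof -
  have [simp]: "euler 1 = 0" "euler 0 = 0"
    using euler_const[of 1] euler_const[of 0] by (simp_all add: one_fun_def zero_fun_def)
  have 1: "nprod lam [:f:] tgen = [:0, f:]"
    by (simp add: nprod_def)
  have 2: "nprod lam tgen [:f:] = [:- (\<lambda>x. lam * euler f x), f:]"
  proof (cases "f = 0")
    case False
    then show ?thesis
      by (simp add: nprod_def tmul_def map_poly_pCons fun_eq_iff)
  next
    case True
    have [simp]: "(\<lambda>x::real^3. lam * euler 0 x) = 0"
      by (rule ext) simp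
    from True show ?thesis
      by (simp add: nprod_def tmul_def flip: zero_fun_def)
  qed
  show ?thesis
    unfolding 1 2 by simp
qed

lemma npow_tgen: "npow lam tgen n = monom 1 n"
proof (induction n)
  case 0
  show ?case by (simp add: npow_def one_fun_def flip: monom_eq_1)
next
  case (Suc n)
  have e: "euler 1 = 0" "euler 0 = 0"
    using euler_const[of 1] euler_const[of 0] by (simp_all add: one_fun_def zero_fun_def)
  have "map_poly euler (monom 1 n) = 0"
    by (simp add: poly_eq_iff coeff_map_poly e)
  then have "tmul lam (monom 1 n) = monom 1 (Suc n)"
    by (simp add: tmul_def monom_Suc)
  moreover have "nprod lam tgen B = tmul lam B" for B
    by (simp add: nprod_def)
  ultimately show ?case
    using Suc unfolding npow_def funpow.simps o_apply by metis
qed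

(* The difference quotient (g(t) - g(t - lam)) / lam.  Constants commute with t, so that
   substituting t - lam for t to the right of the coefficients is the library composition. *)
definition partial0 :: "complex \<Rightarrow> spacefun poly \<Rightarrow> spacefun poly" where
  "partial0 lam g = smult (\<lambda>_. 1 / lam) (g - pcompose g [:\<lambda>_. - lam, 1:])"

definition Delta0_pow :: "complex \<Rightarrow> spacefun \<Rightarrow> nat \<Rightarrow> spacefun poly" where
  "Delta0_pow lam b n =
     (\<Sum>i<n. nprod lam (nprod lam (partial0 lam (npow lam tgen (n - 1 - i))) [:b:])
                     (npow lam [:\<lambda>_. lam, 1:] i))"

definition Delta0 :: "complex \<Rightarrow> spacefun \<Rightarrow> spacefun poly \<Rightarrow> spacefun poly" where
  "Delta0 lam b A = (\<Sum>n\<le>degree A. smult (poly.coeff A n) (Delta0_pow lam b n))"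

(* Normal ordered expressions that are infinite series in t: the coefficient of t^k is a
   function on space.  Only the left multiplication by functions is used. *)
definition exp_it :: "real \<Rightarrow> spacefun fps" where
  "exp_it \<omega> = Abs_fps (\<lambda>k. \<lambda>x. (\<i> * of_real \<omega>) ^ k / fact k)"

(* The coefficient of omega^n t^k at the point x in the termwise image of exp_it omega, that is
   in the sum over n of (i omega)^n / n! * Delta0 (t^n). *)
definition Delta0_exp_coeff :: "complex \<Rightarrow> spacefun \<Rightarrow> nat \<Rightarrow> real^3 \<Rightarrow> nat \<Rightarrow> complex" where
  "Delta0_exp_coeff lam b k x n =
     \<i> ^ n / fact n * poly.coeff (Delta0 lam b (npow lam tgen n)) k x"

(* The power series with coefficients a, continued analytically from 0 along the straight
   segment to omega, has the value s at omega. *)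
definition has_continued_sum :: "(nat \<Rightarrow> complex) \<Rightarrow> real \<Rightarrow> complex \<Rightarrow> bool" where
  "has_continued_sum a \<omega> s \<longleftrightarrow>
     (\<exists>W G. open W \<and> connected W \<and> closed_segment 0 (of_real \<omega>) \<subseteq> W \<and> G holomorphic_on W \<and>
        (\<forall>\<^sub>F w in nhds 0. (\<lambda>n. a n * w ^ n) sums G w) \<and> G (of_real \<omega>) = s)"

lemma has_continued_sum_unique:
  assumes "has_continued_sum a \<omega> s" "has_continued_sum a \<omega> s'"
  shows "s = s'"
proof -
  from assms obtain V G W H where
    V: "open V" "closed_segment 0 (of_real \<omega>) \<subseteq> V" "G holomorphic_on V"
      "\<forall>\<^sub>F w in nhds 0. (\<lambda>n. a n * w ^ n) sums G w" "G (of_real \<omega>) = s" and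
    W: "open W" "closed_segment 0 (of_real \<omega>) \<subseteq> W" "H holomorphic_on W"
      "\<forall>\<^sub>F w in nhds 0. (\<lambda>n. a n * w ^ n) sums H w" "H (of_real \<omega>) = s'"
    unfolding has_continued_sum_def by blast
  define C where "C = connected_component_set (V \<inter> W) 0"
  have "closed_segment 0 (complex_of_real \<omega>) \<subseteq> C"
    unfolding C_def using V W by (intro connected_component_maximal) auto
  then have "0 \<in> C" "of_real \<omega> \<in> C"
    by auto
  moreover have "open C" "connected C"
    using V(1) W(1) by (auto simp: C_def intro: open_connected_component)
  moreover have "C \<subseteq> V \<inter> W"
    unfolding C_def by (rule connected_component_subset)
  ultimately have C: "open C" "connected C" "C \<subseteq> V \<inter> W" "0 \<in> C" "of_real \<omega> \<in> C"
    by auto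
  have "\<forall>\<^sub>F w in nhds 0. G w = H w"
    using V(4) W(4) by eventually_elim (rule sums_unique2)
  then obtain U where U: "open U" "0 \<in> U" "\<And>w. w \<in> U \<Longrightarrow> G w = H w"
    unfolding eventually_nhds by blast
  have "G (of_real \<omega>) = H (of_real \<omega>)"
  proof (rule analytic_continuation_open[of "U \<inter> C" C G H])
    show "G holomorphic_on C" "H holomorphic_on C"
      using V(3) W(3) C(3) by (auto intro: holomorphic_on_subset)
  qed (use U C in auto)
  with V W show ?thesis by simp
qed

lemma has_continued_sum_sums:
  assumes "ereal \<bar>\<omega>\<bar> < conv_radius a"
  shows "has_continued_sum a \<omega> (\<Sum>n. a n * of_real \<omega> ^ n)"
proof -
  obtain \<rho> where \<rho>: "\<bar>\<omega>\<bar> < \<rho>" "ereal \<rho> < conv_radius a"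
    using ereal_dense2[OF assms] by auto
  let ?G = "\<lambda>w. \<Sum>n. a n * w ^ n"
  have sums: "(\<lambda>n. a n * w ^ n) sums ?G w" if "w \<in> ball 0 \<rho>" for w
  proof -
    have "ereal (norm w) < conv_radius a"
      using that \<rho>(2) by (auto intro: less_trans[of _ "ereal \<rho>"])
    then show ?thesis
      by (intro summable_sums summable_in_conv_radius)
  qed
  have "?G holomorphic_on ball 0 \<rho>"
    by (rule power_series_holomorphic[where a = a]) (use sums in simp)
  moreover have "closed_segment 0 (complex_of_real \<omega>) \<subseteq> ball 0 \<rho>"
    using \<rho>(1) by (intro closed_segment_subset) auto
  moreover have "\<forall>\<^sub>F w in nhds 0. (\<lambda>n. a n * w ^ n) sums ?G w"
    using sums \<rho>(1) by (intro eventually_nhds_in_open[of "ball 0 \<rho>", THEN eventually_mono]) auto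
  ultimately show ?thesis
    unfolding has_continued_sum_def
    by (intro exI[of _ "ball 0 \<rho>"] exI[of _ ?G]) auto
qed

(* Delta0 applied termwise to exp_it omega equals E at the point x, coefficient by coefficient.
   For given x the series in n has a finite radius of convergence in omega (b may have a
   singularity on the ray through x), so that for large omega it is summed by analytic
   continuation; by the two preceding lemmas the value is unique, and it is the ordinary sum
   inside the disc of convergence. *)
definition Delta0_exp_eq_at ::
    "complex \<Rightarrow> spacefun \<Rightarrow> real \<Rightarrow> spacefun fps \<Rightarrow> real^3 \<Rightarrow> bool" where
  "Delta0_exp_eq_at lam b \<omega> E x \<longleftrightarrow>
     (\<forall>k. has_continued_sum (Delta0_exp_coeff lam b k x) \<omega> (fps_nth E k x))"

definition schwarzschild_beta :: "real \<Rightarrow> real \<Rightarrow> spacefun" where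
  "schwarzschild_beta c \<gamma> x = of_real (- 1 / (c\<^sup>2 * (1 - \<gamma> / norm x)))"

definition log_arg :: "real \<Rightarrow> real \<Rightarrow> real \<Rightarrow> real \<Rightarrow> real" where
  "log_arg \<gamma> lp \<omega> r = (exp (\<omega> * lp) * r - \<gamma>) / (r - \<gamma>)"

definition Dfun :: "real \<Rightarrow> real \<Rightarrow> real \<Rightarrow> real \<Rightarrow> real" where
  "Dfun \<gamma> lp \<omega> r =
     1 / lp\<^sup>2 * (sinh (\<omega> * lp) + exp (- (\<omega> * lp)) * (1 - \<gamma> / r) *
        (1 - exp (\<omega> * lp) - \<gamma> / r * ln (log_arg \<gamma> lp \<omega> r)))"

end

theory Submission
  imports Defs
begin

text \<open>Let \<open>E = r d/dr\<close> be the Euler derivative. The relation \<open>t b = b t - \<lambda> (E b)\<close> says that \<open>t\<close> acts on a function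
\<open>b\<close> from the left as \<open>t - \<lambda> E\<close>. Hence \<open>\<partial>\<^sub>0 t\<^sup>m\<close> times \<open>\<beta>\<close> is \<open>\<lambda>\<^sup>-\<^sup>1 ((t - \<lambda> E)\<^sup>m - (t - \<lambda> (E + 1))\<^sup>m) \<beta>\<close>,
and the geometric sum defining \<open>\<Delta>\<^sub>0 t\<^sup>n\<close> involves differences such as \<open>(t + \<lambda>) - (t - \<lambda> E)\<close> in which \<open>t\<close> cancels. The
\<open>\<Delta>\<^sub>0 t\<^sup>n\<close> therefore form an Appell sequence (\<open>coeff_Delta0_pow\<close>), and \<open>\<Delta>\<^sub>0 e\<^bsup>\<i>\<omega>t\<^esup>\<close> is a function on space times
\<open>e\<^bsup>\<i>\<omega>t\<^esup>\<close>.

That function is found from its dependence on \<open>\<omega>\<close>. Put \<open>z = - \<i> \<lambda> \<omega>\<close>, which is \<open>\<omega> \<lambda>\<^sub>p\<close> for \<open>\<lambda> = \<i> \<lambda>\<^sub>p\<close>. Along the ray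
through \<open>x\<close> put \<open>H z = \<beta> (e\<^sup>z x)\<close>; the derivatives of \<open>H\<close> at 0 are the values of the \<open>E\<^sup>m \<beta>\<close> at \<open>x\<close>, and those of
\<open>e\<^sup>z H z\<close> are the values of the \<open>(E + 1)\<^sup>m \<beta>\<close>. The Appell recursion is the Taylor expansion of the equation
\<open>D' = (1 - e\<^sup>z) H - D\<close>, \<open>D(0) = 0\<close>, and the function sought is \<open>- \<lambda>\<^sup>-\<^sup>2 D\<close> (\<open>Delta0_exp_series\<close>). For the
Schwarzschild \<open>\<beta>\<close>, which is radial, \<open>H\<close> is a rational function of \<open>e\<^sup>z\<close>, and the equation is solved by the closed
formula with the logarithm (\<open>wave_profile_continuation\<close>).

With \<open>\<rho> = \<gamma> / r\<close>, the poles of \<open>H\<close> all have real part \<open>ln \<rho>\<close>. The solution is holomorphic on the half plane of this line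
that contains 0; it contains the disc of radius \<open>\<bar>ln \<rho>\<bar>\<close>, whence the convergence for
\<open>\<bar>\<omega> \<lambda>\<^sub>p\<bar> < \<bar>ln \<rho>\<bar>\<close>, and every real \<open>\<omega> \<lambda>\<^sub>p\<close> for which the logarithm has positive argument, whence the
continuation along the segment from 0 (\<open>log_on_halfplane\<close>).

Of the limits, the one for \<open>\<lambda>\<^sub>p \<rightarrow> 0\<close> reads off the second derivative at 0 from the differential equation, the one for
\<open>r \<rightarrow> \<infinity>\<close> is continuity at \<open>\<rho> = 0\<close>, and the one for \<open>r \<rightarrow> \<gamma>\<close> rests on \<open>y ln y \<rightarrow> 0\<close>.\<close>

section \<open>Normal ordering and the coefficients of the images of powers of t\<close>

lemma sum_fun_apply: "(\<Sum>i\<in>A. f i) x = (\<Sum>i\<in>A. f i x)"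
  for f :: "'a \<Rightarrow> 'b \<Rightarrow> 'c::comm_monoid_add"
  by (induction A rule: infinite_finite_induct) auto

lemma power_fun_apply: "(f ^ n) x = f x ^ n"
  for f :: "'b \<Rightarrow> 'c::comm_semiring_1"
  by (induction n) auto

lemma nprod_eq_sum:
  assumes "degree A \<le> N"
  shows "nprod lam A B = (\<Sum>n\<le>N. smult (poly.coeff A n) ((tmul lam ^^ n) B))"
  unfolding nprod_def
  by (rule sum.mono_neutral_left) (use assms in \<open>auto simp: coeff_eq_0\<close>)

text \<open>Polynomials in \<open>t\<close> alone commute with \<open>t\<close>; on them the noncommutative product collapses to the product of
polynomials, which disposes of all the factors \<open>(t + \<lambda>)\<^sup>i\<close>.\<close>
definition constant_coeffs :: "spacefun poly \<Rightarrow> bool" where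
  "constant_coeffs C \<longleftrightarrow> (\<forall>k. \<exists>a. poly.coeff C k = (\<lambda>_. a))"

lemma constant_coeffs_pCons:
  "constant_coeffs C \<Longrightarrow> constant_coeffs (pCons (\<lambda>_. a) C)"
  unfolding constant_coeffs_def coeff_pCons by (auto split: nat.split)

lemma constant_coeffs_mult:
  assumes "constant_coeffs A" "constant_coeffs B"
  shows "constant_coeffs (A * B)"
proof -
  obtain a b where "\<And>k. poly.coeff A k = (\<lambda>_. a k)" "\<And>k. poly.coeff B k = (\<lambda>_. b k)"
    using assms unfolding constant_coeffs_def by metis
  then have "poly.coeff (A * B) k = (\<lambda>_. \<Sum>i\<le>k. a i * b (k - i))" for k
    by (simp add: coeff_mult fun_eq_iff sum_fun_apply)
  then show ?thesis
    unfolding constant_coeffs_def by blast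
qed

lemma constant_coeffs_1: "constant_coeffs 1"
  by (auto simp: constant_coeffs_def one_fun_def zero_fun_def)

lemma constant_coeffs_linear_power: "constant_coeffs ([:\<lambda>_. a, 1:] ^ n)"
proof -
  have "constant_coeffs [:\<lambda>_. a, \<lambda>_. 1:]"
    by (intro constant_coeffs_pCons) (auto simp: constant_coeffs_def zero_fun_def)
  then have "constant_coeffs [:\<lambda>_. a, 1:]"
    by (simp add: one_fun_def)
  then show ?thesis
    by (induction n) (simp_all only: power_0 power_Suc constant_coeffs_1 constant_coeffs_mult)
qed

lemma tmul_constant_coeffs:
  assumes "constant_coeffs C"
  shows "tmul lam C = pCons 0 C"
proof -
  have "euler (poly.coeff C k) = 0" for k
  proof -
    obtain a where "poly.coeff C k = (\<lambda>_. a)"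
      using assms unfolding constant_coeffs_def by blast
    then show ?thesis by (simp add: euler_const zero_fun_def)
  qed
  then have "map_poly euler C = 0"
    using euler_const[of 0] by (simp add: poly_eq_iff coeff_map_poly zero_fun_def)
  then show ?thesis
    by (simp add: tmul_def)
qed

lemma nprod_constant_coeffs:
  assumes "constant_coeffs C"
  shows "nprod lam A C = A * C"
proof -
  have *: "(tmul lam ^^ n) C = monom 1 n * C \<and> constant_coeffs (monom 1 n * C)" for n
  proof (induction n)
    case 0
    have "monom 1 0 = (1 :: spacefun poly)" by (rule monom_eq_1)
    then show ?case using assms by (simp only: funpow.simps id_apply mult_1_left)
  next
    case (Suc n)
    then have IH: "(tmul lam ^^ n) C = monom 1 n * C" "constant_coeffs (monom 1 n * C)"
      by blast+
    have step: "monom 1 (Suc n) * C = pCons 0 (monom 1 n * C)"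
      by (simp add: monom_Suc)
    have "constant_coeffs (pCons 0 (monom 1 n * C))"
      unfolding zero_fun_def by (intro constant_coeffs_pCons IH)
    then show ?case
      by (simp only: step funpow.simps o_apply IH(1) tmul_constant_coeffs[OF IH(2)] simp_thms)
  qed
  have "nprod lam A C = (\<Sum>n\<le>degree A. monom (poly.coeff A n) n) * C"
    by (simp add: nprod_def * sum_distrib_right smult_monom flip: mult_smult_left)
  then show ?thesis
    by (simp add: poly_as_sum_of_monoms)
qed

lemma npow_linear: "npow lam [:\<lambda>_. a, 1:] n = [:\<lambda>_. a, 1:] ^ n"
proof (induction n)
  case (Suc n)
  then have "npow lam [:\<lambda>_. a, 1:] (Suc n) = nprod lam [:\<lambda>_. a, 1:] ([:\<lambda>_. a, 1:] ^ n)"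
    by (simp only: npow_def funpow.simps o_apply)
  then show ?case
    by (simp only: nprod_constant_coeffs constant_coeffs_linear_power power_Suc)
qed (simp add: npow_def)

lemma Delta0_monom: "Delta0 lam b (monom 1 n) = Delta0_pow lam b n"
proof -
  have "Delta0 lam b (monom 1 n) = (\<Sum>i\<in>{n}. smult (poly.coeff (monom 1 n) i) (Delta0_pow lam b i))"
    unfolding Delta0_def by (rule sum.mono_neutral_right) (auto simp: degree_monom_eq)
  then show ?thesis by simp
qed

text \<open>This recursion replaces the sum defining \<open>\<Delta>\<^sub>0 t\<^sup>n\<close>. The index \<open>i = 0\<close> gives the first summand, and one
factor \<open>t + \<lambda>\<close> splits off on the right of all the others.\<close>
lemma Delta0_pow_Suc:
  "Delta0_pow lam b (Suc n) =
     nprod lam (partial0 lam (monom 1 n)) [:b:] + Delta0_pow lam b n * [:\<lambda>_. lam, 1:]"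
proof -
  have eq: "Delta0_pow lam b m = (\<Sum>i<m. nprod lam (partial0 lam (monom 1 (m - 1 - i))) [:b:] *
              [:\<lambda>_. lam, 1:] ^ i)" for m
    unfolding Delta0_pow_def npow_tgen npow_linear
    by (simp add: nprod_constant_coeffs constant_coeffs_linear_power)
  show ?thesis
    unfolding eq sum.lessThan_Suc_shift
    by (simp add: sum_distrib_left mult_ac del: mult_pCons_left mult_pCons_right)
qed

text \<open>\<open>euler\<close> takes an arbitrary value at a point where its argument is not differentiable, so it is linear
only on differentiable functions. Since \<open>U\<close> is open, the iterates on \<open>U\<close> depend only on the
restriction of \<open>b\<close> to \<open>U\<close>.\<close>
definition euler_smooth_on :: "(real^3) set \<Rightarrow> spacefun \<Rightarrow> bool" where
  "euler_smooth_on U b \<longleftrightarrow> open U \<and> (\<forall>m. \<forall>y\<in>U. (euler ^^ m) b differentiable at y)"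

lemma euler_cong_open:
  assumes "f differentiable at y" "open U" "y \<in> U" "\<And>z. z \<in> U \<Longrightarrow> g z = f z"
  shows "euler g y = euler f y"
  using frechet_derivative_transform_within_open[OF assms(1-3), of g] assms(4)
  by (simp add: euler_def)

lemma euler_cmult:
  assumes "f differentiable at y"
  shows "euler (\<lambda>z. a * f z) y = a * euler f y"
proof -
  have "(f has_derivative frechet_derivative f (at y)) (at y)"
    using assms by (simp add: frechet_derivative_works)
  then have "((\<lambda>z. a * f z) has_derivative (\<lambda>h. a * frechet_derivative f (at y) h)) (at y)"
    by (rule has_derivative_mult_right)
  then show ?thesis
    unfolding euler_def by (simp flip: frechet_derivative_at)
qed

text \<open>Since \<open>t b = b t - \<lambda> (E b)\<close>, where \<open>E\<close> is the Euler derivative, left multiplication by \<open>t\<close> acts on \<open>b\<close> as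
\<open>t - \<lambda> E\<close> with \<open>t\<close> and \<open>E\<close> commuting. This is the binomial expansion of \<open>(t - \<lambda> E)\<^sup>j b\<close>.\<close>
lemma coeff_tmul_power:
  assumes b: "euler_smooth_on U b" and "y \<in> U"
  shows "poly.coeff ((tmul lam ^^ j) [:b:]) k y =
           of_nat (j choose k) * (- lam) ^ (j - k) * (euler ^^ (j - k)) b y"
  using \<open>y \<in> U\<close>
proof (induction j arbitrary: k y)
  case 0
  then show ?case by (simp add: coeff_pCons split: nat.split)
next
  case (Suc j)
  let ?B = "(tmul lam ^^ j) [:b:]"
  have "euler (poly.coeff ?B k) y =
          euler (\<lambda>z. of_nat (j choose k) * (- lam) ^ (j - k) * (euler ^^ (j - k)) b z) y"
    using b Suc by (intro euler_cong_open[of _ _ U])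
      (auto simp: euler_smooth_on_def intro: differentiable_cmult_left_iff[THEN iffD2])
  also have "\<dots> = of_nat (j choose k) * (- lam) ^ (j - k) * (euler ^^ (Suc (j - k))) b y"
    using b Suc.prems by (subst euler_cmult) (auto simp: euler_smooth_on_def)
  finally have E: "euler (poly.coeff ?B k) y =
    of_nat (j choose k) * (- lam) ^ (j - k) * (euler ^^ (Suc (j - k))) b y" .
  have "euler 0 = 0"
    using euler_const[of 0] by (simp add: zero_fun_def)
  then have step: "poly.coeff ((tmul lam ^^ Suc j) [:b:]) k y =
      (case k of 0 \<Rightarrow> 0 | Suc k' \<Rightarrow> poly.coeff ?B k' y) - lam * euler (poly.coeff ?B k) y"
    by (simp add: tmul_def coeff_map_poly coeff_pCons split: nat.split)
  show ?case
  proof (cases "k \<le> j")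
    case True
    then have "Suc j - k = Suc (j - k)" by simp
    then show ?thesis
      unfolding step E by (cases k) (simp_all add: Suc algebra_simps)
  next
    case False
    then show ?thesis
      unfolding step E by (cases k) (simp_all add: Suc binomial_eq_0)
  qed
qed

lemma pcompose_monom_1: "pcompose (monom 1 n) q = q ^ n"
  for q :: "'a::comm_ring_1 poly"
proof (induction n)
  case 0
  show ?case by (simp only: monom_eq_1 pcompose_1 power_0)
qed (simp add: monom_Suc pcompose_pCons)

text \<open>As operators on \<open>b\<close>, \<open>t\<^sup>n\<close> is \<open>(t - \<lambda> E)\<^sup>n\<close> and \<open>(t - \<lambda>)\<^sup>n\<close> is \<open>(t - \<lambda> (E + 1))\<^sup>n\<close>. The difference quotient
therefore has \<open>(n choose k) \<lambda>\<^sup>-\<^sup>1 (- \<lambda>)\<^sup>m (E\<^sup>m b - (E + 1)\<^sup>m b)\<close> with \<open>m = n - k\<close> as its coefficient at \<open>t\<^sup>k\<close>; the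
sum below is \<open>(E + 1)\<^sup>m b\<close>.\<close>
lemma coeff_partial0_nprod:
  assumes b: "euler_smooth_on U b" and y: "y \<in> U"
  shows "poly.coeff (nprod lam (partial0 lam (monom 1 n)) [:b:]) k y =
     of_nat (n choose k) * (1 / lam * (- lam) ^ (n - k) *
       ((euler ^^ (n - k)) b y - (\<Sum>i\<le>n - k. of_nat (n - k choose i) * (euler ^^ i) b y)))"
proof -
  define g where "g = partial0 lam (monom 1 n)"
  have g: "g = smult (\<lambda>_. 1 / lam) (monom 1 n - [:\<lambda>_. - lam, 1:] ^ n)"
    by (simp add: g_def partial0_def pcompose_monom_1)
  have deg: "degree ([:\<lambda>_. - lam, 1:] ^ n :: spacefun poly) \<le> n"
    using degree_power_le[of "[:\<lambda>_. - lam, 1:] :: spacefun poly" n] by simp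
  have "degree g \<le> n"
    unfolding g using deg by (intro order_trans[OF degree_smult_le] degree_diff_le) (simp_all add: degree_monom_le)
  have cg: "poly.coeff g j z = 1 / lam * ((if j = n then 1 else 0) - of_nat (n choose j) * (- lam) ^ (n - j))"
    for j z
    unfolding g
    by (cases "j \<le> n")
       (auto simp: coeff_linear_poly_power power_fun_apply coeff_eq_0 le_less_trans[OF deg])
  define e where "e j = (euler ^^ j) b y" for j
  have "poly.coeff (nprod lam g [:b:]) k y =
      (\<Sum>j\<le>n. poly.coeff g j y * (of_nat (j choose k) * (- lam) ^ (j - k) * e (j - k)))"
    unfolding nprod_eq_sum[OF \<open>degree g \<le> n\<close>] e_def
    by (simp add: coeff_sum sum_fun_apply coeff_tmul_power[OF b y])
  also have "\<dots> = (\<Sum>j\<le>n. 1 / lam *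
      ((if j = n then of_nat (n choose k) * (- lam) ^ (n - k) * e (n - k) else 0) -
       of_nat ((n choose j) * (j choose k)) * ((- lam) ^ (n - j) * (- lam) ^ (j - k)) * e (j - k)))"
    unfolding cg by (intro sum.cong) (auto simp: algebra_simps)
  also have "\<dots> = 1 / lam * (of_nat (n choose k) * (- lam) ^ (n - k) * e (n - k) -
      (\<Sum>j\<le>n. of_nat ((n choose j) * (j choose k)) * ((- lam) ^ (n - j) * (- lam) ^ (j - k)) * e (j - k)))"
    unfolding sum_distrib_left[symmetric] sum_subtractf by (simp add: sum.delta)
  also have "(\<Sum>j\<le>n. of_nat ((n choose j) * (j choose k)) * ((- lam) ^ (n - j) * (- lam) ^ (j - k)) * e (j - k))
      = of_nat (n choose k) * (- lam) ^ (n - k) * (\<Sum>i\<le>n - k. of_nat (n - k choose i) * e i)"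
  proof (cases "k \<le> n")
    case True
    have "(\<Sum>j\<le>n. of_nat ((n choose j) * (j choose k)) * ((- lam) ^ (n - j) * (- lam) ^ (j - k)) * e (j - k))
      = (\<Sum>j=k..n. of_nat ((n choose j) * (j choose k)) * ((- lam) ^ (n - j) * (- lam) ^ (j - k)) * e (j - k))"
      by (rule sum.mono_neutral_right) (auto simp: binomial_eq_0)
    also have "\<dots> = (\<Sum>j=k..n. of_nat ((n choose k) * (n - k choose (j - k))) * (- lam) ^ (n - k) * e (j - k))"
      by (intro sum.cong refl) (simp add: choose_mult flip: power_add)
    also have "\<dots> = (\<Sum>i\<le>n - k. of_nat ((n choose k) * (n - k choose i)) * (- lam) ^ (n - k) * e i)"
      using True by (intro sum.reindex_bij_witness[of _ "\<lambda>i. i + k" "\<lambda>j. j - k"]) auto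
    finally show ?thesis
      by (simp add: sum_distrib_left mult_ac)
  next
    case False
    then show ?thesis by (simp add: binomial_eq_0)
  qed
  finally show ?thesis
    unfolding g_def e_def by (simp add: algebra_simps)
qed

text \<open>The polynomials \<open>\<Delta>\<^sub>0 t\<^sup>n\<close> form an Appell sequence: the coefficients for all \<open>n\<close> and \<open>k\<close> are
binomial multiples of a single sequence \<open>q\<close>. The recursion for \<open>q\<close> turns that for \<open>\<Delta>\<^sub>0 t\<^sup>n\<close> into Pascal's
rule. It follows that \<open>\<Delta>\<^sub>0 e\<^bsup>\<i>\<omega>t\<^esup>\<close> is a function of \<open>\<omega>\<close> and the point times \<open>e\<^bsup>\<i>\<omega>t\<^esup>\<close>.\<close>
lemma coeff_Delta0_pow:
  assumes b: "euler_smooth_on U b" and y: "y \<in> U" and "q 0 = 0"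
    and q: "\<And>m. q (Suc m) = lam * q m + 1 / lam * (- lam) ^ m *
             ((euler ^^ m) b y - (\<Sum>i\<le>m. of_nat (m choose i) * (euler ^^ i) b y))"
  shows "poly.coeff (Delta0_pow lam b n) k y = of_nat (n choose k) * q (n - k)"
proof (induction n arbitrary: k)
  case 0
  show ?case by (simp add: Delta0_pow_def \<open>q 0 = 0\<close>)
next
  case (Suc n)
  have X: "poly.coeff (nprod lam (partial0 lam (monom 1 n)) [:b:]) k y =
      of_nat (n choose k) * (q (Suc (n - k)) - lam * q (n - k))"
    unfolding coeff_partial0_nprod[OF b y] q by simp
  (* The recursion for q identifies the inhomogeneous term with q (Suc (n - k)) - lam * q (n - k),
     so that the contributions of q (n - k) cancel. *)
  have step: "poly.coeff (Delta0_pow lam b (Suc n)) k y =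
      of_nat (n choose k) * (q (Suc (n - k)) - lam * q (n - k)) + lam * (of_nat (n choose k) * q (n - k)) +
      (case k of 0 \<Rightarrow> 0 | Suc k' \<Rightarrow> of_nat (n choose k') * q (n - k'))"
    unfolding Delta0_pow_Suc by (simp add: X Suc coeff_pCons split: nat.split)
  show ?case
  proof (cases "k \<le> n")
    case True
    then have "Suc n - k = Suc (n - k)" by simp
    then show ?thesis
      unfolding step by (cases k) (simp_all add: algebra_simps)
  next
    case False
    then show ?thesis
      unfolding step by (cases k) (simp_all add: binomial_eq_0)
  qed
qed

section \<open>Euler derivatives of radial functions\<close>

lemma has_derivative_radial:
  fixes g :: "complex \<Rightarrow> complex" and y :: "real^3"
  assumes "g field_differentiable at (of_real (ln (norm y)))" "y \<noteq> 0"
  shows "((\<lambda>y. g (of_real (ln (norm y)))) has_derivative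
           (\<lambda>h. deriv g (of_real (ln (norm y))) * of_real (inner y h / (norm y)\<^sup>2))) (at y)"
proof -
  have "(norm has_derivative (\<lambda>h. inner h (sgn y))) (at y)"
    using \<open>y \<noteq> 0\<close> by (rule has_derivative_norm)
  then have "((\<lambda>y. ln (norm y)) has_derivative (\<lambda>h. inner h (sgn y) * inverse (norm y))) (at y)"
    using \<open>y \<noteq> 0\<close> by (auto intro!: derivative_eq_intros)
  then have "((\<lambda>y. complex_of_real (ln (norm y))) has_derivative
               (\<lambda>h. of_real (inner h (sgn y) * inverse (norm y)))) (at y)"
    by (rule has_derivative_of_real)
  moreover have "(g has_derivative (*) (deriv g (of_real (ln (norm y))))) (at (of_real (ln (norm y))))"
    using assms(1) by (simp add: field_differentiable_derivI flip: has_field_derivative_def)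
  ultimately have "((\<lambda>y. g (of_real (ln (norm y)))) has_derivative
      (\<lambda>h. deriv g (of_real (ln (norm y))) * of_real (inner h (sgn y) * inverse (norm y)))) (at y)"
    by (rule has_derivative_compose)
  then show ?thesis
    by (simp add: sgn_div_norm inner_commute power2_eq_square divide_inverse mult_ac)
qed

text \<open>In the variable \<open>ln r\<close> the Euler derivative is the ordinary derivative. Its iterates on a radial function
are thus the derivatives of one holomorphic function, to which Cauchy's theory applies.\<close>
lemma euler_radial:
  assumes "g field_differentiable at (of_real (ln (norm y)))" "y \<noteq> 0"
  shows "euler (\<lambda>y. g (of_real (ln (norm y)))) y = deriv g (of_real (ln (norm y)))"
  using assms(2) unfolding euler_def frechet_derivative_at[OF has_derivative_radial[OF assms], symmetric]
  by (simp add: power2_norm_eq_inner)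

lemma
  assumes H: "H holomorphic_on V" and "open V"
    and U: "U = {y. y \<noteq> 0 \<and> complex_of_real (ln (norm y)) \<in> V}"
    and b: "\<And>y. y \<in> U \<Longrightarrow> b y = H (of_real (ln (norm y)))"
  shows euler_power_radial: "y \<in> U \<Longrightarrow> (euler ^^ m) b y = (deriv ^^ m) H (of_real (ln (norm y)))"
    and euler_smooth_radial: "euler_smooth_on U b"
proof -
  have "continuous_on (- {0}) (\<lambda>y::real^3. complex_of_real (ln (norm y)))"
    by (intro continuous_intros) auto
  then have "open ((- {0}) \<inter> (\<lambda>y::real^3. complex_of_real (ln (norm y))) -` V)"
    using \<open>open V\<close> by (intro continuous_open_preimage) auto
  also have "(- {0}) \<inter> (\<lambda>y::real^3. complex_of_real (ln (norm y))) -` V = U"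
    by (auto simp: U)
  finally have "open U" .
  have g: "(deriv ^^ m) H field_differentiable at (of_real (ln (norm y)))" "y \<noteq> 0" if "y \<in> U" for m y
    using that H \<open>open V\<close>
    by (auto simp: U intro: holomorphic_on_imp_differentiable_at[OF holomorphic_higher_deriv])
  have *: "\<forall>y\<in>U. (euler ^^ m) b y = (deriv ^^ m) H (of_real (ln (norm y)))" for m
  proof (induction m)
    case (Suc m)
    show ?case
    proof
      fix y assume y: "y \<in> U"
      have "euler ((euler ^^ m) b) y = euler (\<lambda>y. (deriv ^^ m) H (of_real (ln (norm y)))) y"
        using has_derivative_radial[OF g[OF y]] Suc y \<open>open U\<close>
        by (intro euler_cong_open[of _ _ U]) (auto simp: differentiable_def)
      also have "\<dots> = deriv ((deriv ^^ m) H) (of_real (ln (norm y)))"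
        by (rule euler_radial[OF g[OF y]])
      finally show "(euler ^^ Suc m) b y = (deriv ^^ Suc m) H (of_real (ln (norm y)))"
        by simp
    qed
  qed (simp add: b)
  then show "y \<in> U \<Longrightarrow> (euler ^^ m) b y = (deriv ^^ m) H (of_real (ln (norm y)))"
    by blast
  show "euler_smooth_on U b"
    unfolding euler_smooth_on_def
  proof (intro conjI allI ballI)
    fix m y assume y: "y \<in> U"
    show "(euler ^^ m) b differentiable at y"
      unfolding differentiable_def
      using has_derivative_transform_within_open[OF has_derivative_radial[OF g[OF y]] \<open>open U\<close> y] *
      by metis
  qed fact
qed

section \<open>The exponential generating function\<close>

lemma higher_deriv_exp: "(deriv ^^ n) exp = (exp :: complex \<Rightarrow> complex)"
proof (induction n)
  case (Suc n)
  have "deriv exp = (exp :: complex \<Rightarrow> complex)"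
    using DERIV_imp_deriv[OF DERIV_exp] by blast
  then show ?case by (simp add: Suc)
qed simp

text \<open>Here \<open>H z\<close> stands for the value of \<open>b\<close> at \<open>e\<^sup>z x\<close>, so that \<open>E\<^sup>m b\<close> and \<open>(E + 1)\<^sup>m b\<close> at \<open>x\<close> are the \<open>m\<close>-th
derivatives at 0 of \<open>H z\<close> and of \<open>e\<^sup>z H z\<close>. The differential equation for \<open>D\<close>, differentiated \<open>m\<close> times at
0, becomes the recursion of the Appell sequence for \<open>q m = - \<lambda>\<^sup>-\<^sup>2 (- \<lambda>)\<^sup>m D\<^bsup>(m)\<^esup>(0)\<close>; the sum over \<open>n\<close> is
then the Taylor series of \<open>D\<close>.\<close>
lemma Delta0_exp_series:
  assumes b: "euler_smooth_on U b" and x: "x \<in> U" and lam: "lam \<noteq> 0"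
    and H: "H holomorphic_on ball 0 R" and Hb: "\<And>m. (euler ^^ m) b x = (deriv ^^ m) H 0"
    and D: "D holomorphic_on ball 0 R" "D 0 = 0"
    and D': "\<And>z. z \<in> ball 0 R \<Longrightarrow> deriv D z = (1 - exp z) * H z - D z"
    and w: "norm (lam * w) < R"
  shows "(\<lambda>n. Delta0_exp_coeff lam b k x n * w ^ n) sums
           ((\<i> * w) ^ k / fact k * (- 1 / lam\<^sup>2 * D (- \<i> * lam * w)))"
proof -
  have R: "0 \<in> ball (0::complex) R"
    using w by (auto intro: le_less_trans[OF norm_ge_zero])
  define d where "d m = (deriv ^^ m) D 0" for m
  define q where "q m = - 1 / lam\<^sup>2 * (- lam) ^ m * d m" for m
  have d_Suc: "d (Suc m) = (euler ^^ m) b x - (\<Sum>i\<le>m. of_nat (m choose i) * (euler ^^ i) b x) - d m" for m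
  proof -
    have "d (Suc m) = (deriv ^^ m) (deriv D) 0"
      unfolding d_def funpow_Suc_right by simp
    also have "\<dots> = (deriv ^^ m) (\<lambda>z. (H z - H z * exp z) - D z) 0"
      by (rule higher_deriv_transform_within_open[of _ "ball 0 R"])
         (use R D' in \<open>auto simp: algebra_simps intro!: holomorphic_intros H D(1)\<close>)
    also have "\<dots> = (deriv ^^ m) (\<lambda>z. H z - H z * exp z) 0 - d m"
      unfolding d_def
      by (rule higher_deriv_diff[of _ "ball 0 R"]) (use R in \<open>auto intro!: holomorphic_intros H D(1)\<close>)
    also have "(deriv ^^ m) (\<lambda>z. H z - H z * exp z) 0 = (deriv ^^ m) H 0 - (deriv ^^ m) (\<lambda>z. H z * exp z) 0"
      by (rule higher_deriv_diff[of _ "ball 0 R"]) (use R in \<open>auto intro!: holomorphic_intros H\<close>)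
    also have "(deriv ^^ m) (\<lambda>z. H z * exp z) 0 =
        (\<Sum>i=0..m. of_nat (m choose i) * (deriv ^^ i) H 0 * (deriv ^^ (m - i)) exp 0)"
      by (rule higher_deriv_mult[of _ "ball 0 R"]) (use R in \<open>auto intro!: holomorphic_intros H\<close>)
    finally show ?thesis
      by (simp add: higher_deriv_exp Hb atLeast0AtMost)
  qed
  have q_Suc: "q (Suc m) = lam * q m + 1 / lam * (- lam) ^ m *
          ((euler ^^ m) b x - (\<Sum>i\<le>m. of_nat (m choose i) * (euler ^^ i) b x))" for m
    unfolding q_def d_Suc using lam by (simp add: field_simps power2_eq_square)
  have q_0: "q 0 = 0"
    by (simp add: q_def d_def D)
  have coeff: "Delta0_exp_coeff lam b k x n = \<i> ^ n / fact n * (of_nat (n choose k) * q (n - k))" for n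
    unfolding Delta0_exp_coeff_def npow_tgen Delta0_monom coeff_Delta0_pow[OF b x q_0 q_Suc] ..
  have "- \<i> * lam * w \<in> ball 0 R"
    using w by (simp add: norm_mult)
  then have "(\<lambda>n. d n / fact n * (- \<i> * lam * w) ^ n) sums D (- \<i> * lam * w)"
    using holomorphic_power_series[OF D(1)] by (simp add: d_def)
  then have sums: "(\<lambda>n. (\<i> * w) ^ k / fact k * (- 1 / lam\<^sup>2 * (d n / fact n * (- \<i> * lam * w) ^ n))) sums
               ((\<i> * w) ^ k / fact k * (- 1 / lam\<^sup>2 * D (- \<i> * lam * w)))"
    by (intro sums_mult)
  have rearrange: "a * b / f * (- 1 / l * (e / g * (p * m * v))) =
      p * a / h * (h / (f * g) * (- 1 / l * m * e)) * (v * b)"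
    if "h \<noteq> 0" for a b e f g h l m p v :: complex
    using that by (simp add: mult_ac)
  note sums
  also have "(\<lambda>n. (\<i> * w) ^ k / fact k * (- 1 / lam\<^sup>2 * (d n / fact n * (- \<i> * lam * w) ^ n))) =
               (\<lambda>n. Delta0_exp_coeff lam b k x (n + k) * w ^ (n + k))"
  proof
    fix n
    have pow: "(- \<i> * lam * w) ^ n = \<i> ^ n * (- lam) ^ n * w ^ n"
      by (simp flip: power_mult_distrib)
    have bin: "of_nat (n + k choose k) = (fact (n + k) / (fact k * fact n) :: complex)"
      by (subst binomial_fact) auto
    show "(\<i> * w) ^ k / fact k * (- 1 / lam\<^sup>2 * (d n / fact n * (- \<i> * lam * w) ^ n)) =
        Delta0_exp_coeff lam b k x (n + k) * w ^ (n + k)"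
      unfolding coeff bin pow q_def power_add add_diff_cancel_right'
        power_mult_distrib[of \<i> w]
      by (rule rearrange) simp
  qed
  (* The terms with n < k vanish, since Delta0 (t^n) has degree below n + 1. *)
  finally show ?thesis
    by (subst (asm) sums_zero_iff_shift) (simp_all add: coeff binomial_eq_0)
qed

section \<open>The Schwarzschild profile and its analytic continuation\<close>

text \<open>The zeros \<open>ln \<rho> + 2 \<pi> \<i> k\<close> of \<open>e\<^sup>z - \<rho>\<close> lie on one vertical line. The open half plane on the side of 0
is convex, contains the disc up to the nearest zero, and meets the real axis exactly where the argument of the
logarithm is positive. The principal branch of \<open>Ln ((e\<^sup>z - \<rho>) / (1 - \<rho>))\<close> is not continuous
there if \<open>\<rho> < 1\<close>, because \<open>e\<^sup>z\<close> takes large negative values; taking the factor \<open>e\<^sup>z\<close> out leaves an argument in the right half plane.\<close>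
lemma log_on_halfplane:
  fixes \<rho> :: real
  assumes "\<rho> > 0" "\<rho> \<noteq> 1"
  obtains S :: "complex set" and L :: "complex \<Rightarrow> complex" where
    "open S" "convex S" "ball 0 \<bar>ln \<rho>\<bar> \<subseteq> S" "\<And>z. z \<in> S \<Longrightarrow> exp z \<noteq> of_real \<rho>"
    "\<And>z. z \<in> S \<Longrightarrow> (L has_field_derivative exp z / (exp z - of_real \<rho>)) (at z)"
    "\<And>u. (exp u - \<rho>) / (1 - \<rho>) > 0 \<Longrightarrow>
       of_real u \<in> S \<and> L (of_real u) = of_real (ln ((exp u - \<rho>) / (1 - \<rho>)))"
proof (cases "\<rho> < 1")
  case True
  define S where "S = {z. Re z > ln \<rho>}"
  define L where "L z = z + Ln ((1 - of_real \<rho> * exp (- z)) / (1 - of_real \<rho>))" for z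
  have pos: "Re (1 - of_real \<rho> * exp (- z)) > 0" if "z \<in> S" for z
  proof -
    have "Re (of_real \<rho> * exp (- z)) \<le> norm (of_real \<rho> * exp (- z))"
      by (rule complex_Re_le_cmod)
    also have "\<dots> = exp (ln \<rho> - Re z)"
      using assms by (simp add: norm_mult exp_diff exp_minus norm_inverse divide_inverse)
    also have "\<dots> < 1"
      using that by (simp add: S_def)
    finally show ?thesis by simp
  qed
  show ?thesis
  proof (rule that[of S L])
    show "open S" "convex S"
      by (simp_all add: S_def open_halfspace_Re_gt convex_halfspace_Re_gt)
    show "ball 0 \<bar>ln \<rho>\<bar> \<subseteq> S"
    proof
      fix z :: complex assume "z \<in> ball 0 \<bar>ln \<rho>\<bar>"
      then show "z \<in> S"
        using True assms abs_Re_le_cmod[of z] by (simp add: S_def abs_if split: if_splits)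
    qed
    fix z assume z: "z \<in> S"
    show nz: "exp z \<noteq> of_real \<rho>"
    proof
      assume "exp z = of_real \<rho>"
      then have "1 - of_real \<rho> * exp (- z) = 1 - exp z * exp (- z)"
        by (simp only:)
      also have "\<dots> = 0"
        by (simp add: exp_minus)
      finally have "1 - of_real \<rho> * exp (- z) = 0" .
      with pos[OF z] show False by simp
    qed
    have "Re ((1 - of_real \<rho> * exp (- z)) / (1 - of_real \<rho>)) =
          Re (1 - of_real \<rho> * exp (- z)) / (1 - \<rho>)"
      by (metis Re_divide_of_real of_real_1 of_real_diff)
    also have "\<dots> > 0"
      using pos[OF z] True by (intro divide_pos_pos) auto
    finally have "(1 - of_real \<rho> * exp (- z)) / (1 - of_real \<rho>) \<notin> \<real>\<^sub>\<le>\<^sub>0"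
      by (auto simp: complex_nonpos_Reals_iff)
    moreover have "1 - complex_of_real \<rho> \<noteq> 0"
      using assms by (metis eq_iff_diff_eq_0 of_real_eq_1_iff)
    moreover have "1 - of_real \<rho> * exp (- z) \<noteq> 0"
      using pos[OF z] by (metis less_irrefl zero_complex.simps(1))
    ultimately have "(L has_field_derivative 1 + of_real \<rho> * exp (- z) / (1 - of_real \<rho> * exp (- z))) (at z)"
      unfolding L_def by (auto intro!: derivative_eq_intros)
    also have "1 - of_real \<rho> * exp (- z) = (exp z - of_real \<rho>) / exp z"
      by (simp add: exp_minus field_simps)
    also have "1 + of_real \<rho> * exp (- z) / ((exp z - of_real \<rho>) / exp z) = exp z / (exp z - of_real \<rho>)"
      using nz by (simp add: exp_minus divide_simps)
    finally show "(L has_field_derivative exp z / (exp z - of_real \<rho>)) (at z)" .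
  next
    fix u :: real assume u: "(exp u - \<rho>) / (1 - \<rho>) > 0"
    then have "exp u > \<rho>"
      using True by (simp add: zero_less_divide_iff)
    then have "u > ln \<rho>"
      using assms by (metis exp_gt_zero ln_exp ln_less_cancel_iff)
    have fac: "(exp u - \<rho>) / (1 - \<rho>) = exp u * ((1 - \<rho> * exp (- u)) / (1 - \<rho>))"
      by (simp add: exp_minus right_diff_distrib)
    have v: "(1 - \<rho> * exp (- u)) / (1 - \<rho>) > 0"
      using True \<open>exp u > \<rho>\<close> by (simp add: exp_minus field_simps)
    have "ln ((exp u - \<rho>) / (1 - \<rho>)) = u + ln ((1 - \<rho> * exp (- u)) / (1 - \<rho>))"
      unfolding fac by (subst ln_mult_pos[OF exp_gt_zero v]) simp
    moreover have "(1 - of_real \<rho> * exp (- of_real u)) / (1 - of_real \<rho>) =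
        complex_of_real ((1 - \<rho> * exp (- u)) / (1 - \<rho>))"
      by (simp flip: exp_of_real)
    ultimately show "of_real u \<in> S \<and> L (of_real u) = of_real (ln ((exp u - \<rho>) / (1 - \<rho>)))"
      using \<open>u > ln \<rho>\<close> v unfolding L_def S_def by (simp only: Ln_of_real) simp
  qed
next
  case False
  with assms have "\<rho> > 1" by simp
  define S where "S = {z. Re z < ln \<rho>}"
  define L where "L z = Ln ((exp z - of_real \<rho>) / (1 - of_real \<rho>))" for z
  have pos: "Re (exp z - of_real \<rho>) < 0" if "z \<in> S" for z
  proof -
    have "Re (exp z) \<le> norm (exp z)"
      by (rule complex_Re_le_cmod)
    also have "\<dots> < \<rho>"
      using that assms by (simp add: S_def) (metis exp_less_cancel_iff exp_ln)
    finally show ?thesis by simp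
  qed
  show ?thesis
  proof (rule that[of S L])
    show "open S" "convex S"
      by (simp_all add: S_def open_halfspace_Re_lt convex_halfspace_Re_lt)
    show "ball 0 \<bar>ln \<rho>\<bar> \<subseteq> S"
    proof
      fix z :: complex assume "z \<in> ball 0 \<bar>ln \<rho>\<bar>"
      then show "z \<in> S"
        using \<open>\<rho> > 1\<close> abs_Re_le_cmod[of z] by (simp add: S_def abs_if split: if_splits)
    qed
    fix z assume z: "z \<in> S"
    show nz: "exp z \<noteq> of_real \<rho>"
      using pos[OF z] by auto
    have "Re ((exp z - of_real \<rho>) / (1 - of_real \<rho>)) = Re (exp z - of_real \<rho>) / (1 - \<rho>)"
      by (metis Re_divide_of_real of_real_1 of_real_diff)
    also have "\<dots> > 0"
      using pos[OF z] \<open>\<rho> > 1\<close> by (intro divide_neg_neg) auto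
    finally have "(exp z - of_real \<rho>) / (1 - of_real \<rho>) \<notin> \<real>\<^sub>\<le>\<^sub>0"
      by (auto simp: complex_nonpos_Reals_iff)
    moreover have "1 - complex_of_real \<rho> \<noteq> 0"
      using assms by (metis eq_iff_diff_eq_0 of_real_eq_1_iff)
    ultimately show "(L has_field_derivative exp z / (exp z - of_real \<rho>)) (at z)"
      unfolding L_def using nz
      by (auto intro!: derivative_eq_intros)
  next
    fix u :: real assume u: "(exp u - \<rho>) / (1 - \<rho>) > 0"
    then have "exp u < \<rho>"
      using \<open>\<rho> > 1\<close> by (simp add: zero_less_divide_iff)
    then have "u < ln \<rho>"
      using assms by (metis exp_gt_zero ln_exp ln_less_cancel_iff)
    moreover have "(exp (of_real u) - of_real \<rho>) / (1 - of_real \<rho>) =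
        complex_of_real ((exp u - \<rho>) / (1 - \<rho>))"
      by (simp flip: exp_of_real)
    ultimately show "of_real u \<in> S \<and> L (of_real u) = of_real (ln ((exp u - \<rho>) / (1 - \<rho>)))"
      using u unfolding L_def S_def by (simp only: Ln_of_real) simp
  qed
qed

text \<open>\<open>D(\<omega>, r)\<close> depends on its arguments only through \<open>\<rho> = \<gamma> / r\<close> and \<open>u = \<omega> \<lambda>\<^sub>p\<close>, apart from the factor
\<open>1 / \<lambda>\<^sub>p\<^sup>2\<close>.\<close>
definition wave_profile :: "real \<Rightarrow> real \<Rightarrow> real" where
  "wave_profile \<rho> u = sinh u + exp (- u) * (1 - \<rho>) * (1 - exp u - \<rho> * ln ((exp u - \<rho>) / (1 - \<rho>)))"

lemma log_arg_eq:
  assumes "r \<noteq> 0"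
  shows "log_arg \<gamma> lp \<omega> r = (exp (\<omega> * lp) - \<gamma> / r) / (1 - \<gamma> / r)"
proof -
  have "(exp (\<omega> * lp) - \<gamma> / r) / (1 - \<gamma> / r) = (r * (exp (\<omega> * lp) - \<gamma> / r)) / (r * (1 - \<gamma> / r))"
    using assms by simp
  also have "\<dots> = log_arg \<gamma> lp \<omega> r"
    using assms unfolding log_arg_def right_diff_distrib by (simp add: mult.commute)
  finally show ?thesis ..
qed

lemma Dfun_eq_wave_profile:
  assumes "r \<noteq> 0"
  shows "Dfun \<gamma> lp \<omega> r = wave_profile (\<gamma> / r) (\<omega> * lp) / lp\<^sup>2"
  by (simp add: Dfun_def wave_profile_def log_arg_eq[OF assms])

text \<open>With \<open>H z = - c\<^sup>-\<^sup>2 e\<^sup>z / (e\<^sup>z - \<rho>)\<close>, which is the Schwarzschild \<open>\<beta>\<close> along the ray, the right-hand side of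
the differential equation is \<open>c\<^sup>2 (1 - e\<^sup>z) H z - K z\<close>, the equation for \<open>c\<^sup>2\<close>
times the generating function.\<close>
lemma wave_profile_continuation:
  fixes \<rho> :: real
  assumes "\<rho> > 0" "\<rho> \<noteq> 1"
  obtains S :: "complex set" and K :: "complex \<Rightarrow> complex" where
    "open S" "convex S" "ball 0 \<bar>ln \<rho>\<bar> \<subseteq> S" "K holomorphic_on S" "K 0 = 0"
    "\<And>z. z \<in> S \<Longrightarrow> exp z \<noteq> of_real \<rho>"
    "\<And>z. z \<in> S \<Longrightarrow> deriv K z = exp z * (exp z - 1) / (exp z - of_real \<rho>) - K z"
    "\<And>u. (exp u - \<rho>) / (1 - \<rho>) > 0 \<Longrightarrow> of_real u \<in> S \<and> K (of_real u) = of_real (wave_profile \<rho> u)"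
proof -
  obtain S :: "complex set" and L where
    S: "open S" "convex S" "ball 0 \<bar>ln \<rho>\<bar> \<subseteq> S" "\<And>z. z \<in> S \<Longrightarrow> exp z \<noteq> of_real \<rho>"
    and L: "\<And>z. z \<in> S \<Longrightarrow> (L has_field_derivative exp z / (exp z - of_real \<rho>)) (at z)"
    and real: "\<And>u. (exp u - \<rho>) / (1 - \<rho>) > 0 \<Longrightarrow>
       of_real u \<in> S \<and> L (of_real u) = of_real (ln ((exp u - \<rho>) / (1 - \<rho>)))"
    using log_on_halfplane[OF assms] by blast
  define K where "K z = (exp z - exp (- z)) / 2 +
      exp (- z) * (1 - of_real \<rho>) * (1 - exp z - of_real \<rho> * L z)" for z
  have K: "(K has_field_derivative exp z * (exp z - 1) / (exp z - of_real \<rho>) - K z) (at z)" if "z \<in> S" for z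
  proof -
    have nz: "exp z - of_real \<rho> \<noteq> 0"
      using S(4)[OF that] by simp
    (* The derivative of L is kept as a variable l, so that the simplifier meets no fractions here. *)
    have "(K has_field_derivative (exp z + exp (- z)) / 2 -
             exp (- z) * (1 - of_real \<rho>) * (1 - exp z - of_real \<rho> * L z) +
             exp (- z) * (1 - of_real \<rho>) * (- exp z - of_real \<rho> * l)) (at z)"
      if "(L has_field_derivative l) (at z)" for l
      unfolding K_def by (auto intro!: derivative_eq_intros that simp: algebra_simps)
    note this[OF L[OF that]]
    also have "(exp z + exp (- z)) / 2 -
             exp (- z) * (1 - of_real \<rho>) * (1 - exp z - of_real \<rho> * L z) +
             exp (- z) * (1 - of_real \<rho>) * (- exp z - of_real \<rho> * (exp z / (exp z - of_real \<rho>))) =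
             exp z - (1 - of_real \<rho>) * exp z / (exp z - of_real \<rho>) - K z"
      using nz by (simp add: K_def exp_minus divide_simps) (simp add: algebra_simps)
    also have "exp z - (1 - of_real \<rho>) * exp z / (exp z - of_real \<rho>) =
             exp z * (exp z - 1) / (exp z - of_real \<rho>)"
      using nz by (simp add: divide_simps) (simp add: algebra_simps)
    finally show ?thesis .
  qed
  have Kreal: "of_real u \<in> S \<and> K (of_real u) = of_real (wave_profile \<rho> u)"
    if "(exp u - \<rho>) / (1 - \<rho>) > 0" for u
    using real[OF that] by (simp add: K_def wave_profile_def sinh_field_def flip: exp_of_real)
  show ?thesis
  proof (rule that[OF S(1-3) _ _ S(4) _ Kreal])
    show "K holomorphic_on S"
      using K S(1) by (auto simp: holomorphic_on_open)
    show "K 0 = 0"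
      using Kreal[of 0] assms by (simp add: wave_profile_def)
    show "deriv K z = exp z * (exp z - 1) / (exp z - of_real \<rho>) - K z" if "z \<in> S" for z
      using K[OF that] by (rule DERIV_imp_deriv)
  qed
qed

text \<open>The function at the end is \<open>z \<mapsto> \<beta> (e\<^sup>z x)\<close>: in the variable \<open>ln r\<close>, scaling \<open>x\<close> by \<open>e\<^sup>z\<close> is a translation.\<close>
lemma schwarzschild_beta_euler:
  assumes "x \<noteq> 0" "norm x \<noteq> \<gamma>"
    and V: "\<And>z::complex. z \<in> ball 0 R \<Longrightarrow> exp z \<noteq> of_real (\<gamma> / norm x)" and "R > 0"
  obtains U where "euler_smooth_on U (schwarzschild_beta c \<gamma>)" "x \<in> U"
    "\<And>m. (euler ^^ m) (schwarzschild_beta c \<gamma>) x =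
       (deriv ^^ m) (\<lambda>z. - (1 / (of_real c)\<^sup>2 * (exp z / (exp z - of_real (\<gamma> / norm x))))) 0"
proof -
  define H where "H z = - (1 / (of_real c)\<^sup>2 * (exp z / (exp z - of_real \<gamma>)))" for z :: complex
  define V where "V = - {z. exp z = complex_of_real \<gamma>}"
  define U where "U = {y :: real^3. y \<noteq> 0 \<and> complex_of_real (ln (norm y)) \<in> V}"
  have "open V"
    unfolding V_def by (intro open_Compl closed_Collect_eq continuous_intros)
  have H: "H holomorphic_on V"
    unfolding H_def V_def by (auto intro!: holomorphic_intros)
  have e: "exp (complex_of_real (ln (norm y))) = of_real (norm y)" if "y \<noteq> 0" for y :: "real^3"
    using that by (subst exp_of_real) simp
  have bH: "schwarzschild_beta c \<gamma> y = H (of_real (ln (norm y)))" if "y \<in> U" for y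
  proof -
    have "y \<noteq> 0" "norm y \<noteq> \<gamma>"
      using that e[of y] by (auto simp: U_def V_def)
    then have "schwarzschild_beta c \<gamma> y = of_real (- (1 / c\<^sup>2 * (norm y / (norm y - \<gamma>))))"
      unfolding schwarzschild_beta_def by (cases "c = 0") (simp_all add: field_simps)
    then show ?thesis
      unfolding H_def e[OF \<open>y \<noteq> 0\<close>] by simp
  qed
  have "x \<in> U"
    using assms e[of x] by (simp add: U_def V_def)
  show ?thesis
  proof (rule that[OF euler_smooth_radial[OF H \<open>open V\<close> U_def bH] \<open>x \<in> U\<close>])
    fix m
    have shift: "H (1 * z + of_real (ln (norm x))) =
        - (1 / (of_real c)\<^sup>2 * (exp z / (exp z - of_real (\<gamma> / norm x))))" for z
    proof -
      have "exp z * of_real (norm x) / (exp z * of_real (norm x) - of_real \<gamma>) =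
          (of_real (norm x) * exp z) / (of_real (norm x) * (exp z - of_real (\<gamma> / norm x)))"
        using \<open>x \<noteq> 0\<close> by (simp add: algebra_simps)
      also have "\<dots> = exp z / (exp z - of_real (\<gamma> / norm x))"
        using \<open>x \<noteq> 0\<close> by simp
      finally show ?thesis
        using e[OF \<open>x \<noteq> 0\<close>] by (simp add: H_def exp_add)
    qed
    have mem: "1 * z + of_real (ln (norm x)) \<in> V" if "z \<in> ball 0 R" for z :: complex
    proof -
      have "exp z * of_real (norm x) \<noteq> of_real \<gamma>"
        using V[OF that] \<open>x \<noteq> 0\<close> by (auto simp: field_simps)
      then show ?thesis
        using e[OF \<open>x \<noteq> 0\<close>] by (simp add: V_def exp_add)
    qed
    have "(deriv ^^ m) (\<lambda>z. H (1 * z + of_real (ln (norm x)))) 0 =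
        1 ^ m * (deriv ^^ m) H (1 * 0 + of_real (ln (norm x)))"
      using \<open>R > 0\<close> mem by (intro higher_deriv_compose_linear'[OF H open_ball[of 0 R] \<open>open V\<close>]) auto
    then show "(euler ^^ m) (schwarzschild_beta c \<gamma>) x =
       (deriv ^^ m) (\<lambda>z. - (1 / (of_real c)\<^sup>2 * (exp z / (exp z - of_real (\<gamma> / norm x))))) 0"
      unfolding shift using euler_power_radial[OF H \<open>open V\<close> U_def bH \<open>x \<in> U\<close>] by simp
  qed
qed

text \<open>The disc of convergence stays on the side of \<open>ln \<rho>\<close> on which the logarithm is defined.\<close>
lemma log_arg_pos_of_small:
  fixes \<rho> :: real
  assumes "\<rho> > 0" "\<bar>u\<bar> < \<bar>ln \<rho>\<bar>"
  shows "(exp u - \<rho>) / (1 - \<rho>) > 0"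
proof (cases "\<rho> < 1")
  case True
  then have "ln \<rho> < u"
    using assms by (simp add: abs_if split: if_splits)
  then have "\<rho> < exp u"
    using assms by (metis exp_less_cancel_iff exp_ln)
  then show ?thesis
    using True by simp
next
  case False
  then have "u < ln \<rho>" "\<rho> \<noteq> 1"
    using assms by (auto simp: abs_if split: if_splits)
  then have "exp u < \<rho>"
    using assms by (metis exp_less_cancel_iff exp_ln)
  then show ?thesis
    using False \<open>\<rho> \<noteq> 1\<close> by (intro divide_neg_neg) auto
qed

text \<open>The sum of the series near 0 and its continuation to all admissible \<open>\<omega>\<close> are given by the same function \<open>K\<close>,
so this serves both the analytic continuation and the convergence statement.\<close>
lemma Delta0_exp_schwarzschild_series:
  fixes c \<gamma> lp :: real and x :: "real^3"
  defines "\<rho> \<equiv> \<gamma> / norm x"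
  assumes "\<gamma> > 0" "lp \<noteq> 0" "x \<noteq> 0" "norm x \<noteq> \<gamma>"
  obtains S K where "open S" "convex S" "0 \<in> S" "K holomorphic_on S"
    "\<And>u. (exp u - \<rho>) / (1 - \<rho>) > 0 \<Longrightarrow> of_real u \<in> S \<and> K (of_real u) = of_real (wave_profile \<rho> u)"
    "\<And>k w. norm (of_real lp * w) < \<bar>ln \<rho>\<bar> \<Longrightarrow>
       (\<lambda>n. Delta0_exp_coeff (\<i> * of_real lp) (schwarzschild_beta c \<gamma>) k x n * w ^ n) sums
       ((\<i> * w) ^ k / fact k * (K (of_real lp * w) / of_real (c\<^sup>2 * lp\<^sup>2)))"
proof -
  have \<rho>: "\<rho> > 0" "\<rho> \<noteq> 1"
    using assms by (auto simp: \<rho>_def)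
  obtain S K where S: "open S" "convex S" "ball 0 \<bar>ln \<rho>\<bar> \<subseteq> S" "K holomorphic_on S" "K 0 = 0"
    and ne: "\<And>z. z \<in> S \<Longrightarrow> exp z \<noteq> of_real \<rho>"
    and K': "\<And>z. z \<in> S \<Longrightarrow> deriv K z = exp z * (exp z - 1) / (exp z - of_real \<rho>) - K z"
    and real: "\<And>u. (exp u - \<rho>) / (1 - \<rho>) > 0 \<Longrightarrow> of_real u \<in> S \<and> K (of_real u) = of_real (wave_profile \<rho> u)"
    using wave_profile_continuation[OF \<rho>] by metis
  define H where "H z = - (1 / (of_real c)\<^sup>2 * (exp z / (exp z - of_real \<rho>)))" for z :: complex
  have "\<bar>ln \<rho>\<bar> > 0"
    using \<rho> by simp
  obtain U where U: "euler_smooth_on U (schwarzschild_beta c \<gamma>)" "x \<in> U"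
    and E: "\<And>m. (euler ^^ m) (schwarzschild_beta c \<gamma>) x = (deriv ^^ m) H 0"
    using schwarzschild_beta_euler[of x \<gamma> "\<bar>ln \<rho>\<bar>" c] assms(4,5) ne S(3) \<open>\<bar>ln \<rho>\<bar> > 0\<close>
    unfolding H_def[abs_def] \<rho>_def by blast
  have KB: "K holomorphic_on ball 0 \<bar>ln \<rho>\<bar>"
    using S(3,4) holomorphic_on_subset by blast
  have rearrange: "a * (a - 1) / d / e = (1 - a) * - (1 / e * (a / d))" for a d e :: complex
    by (auto simp: divide_simps) (auto simp: algebra_simps)
  have D': "deriv (\<lambda>z. K z / (of_real c)\<^sup>2) z = (1 - exp z) * H z - K z / (of_real c)\<^sup>2"
    if z: "z \<in> ball 0 \<bar>ln \<rho>\<bar>" for z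
  proof -
    have "z \<in> S" "K field_differentiable at z"
      using z S by (auto intro: holomorphic_on_imp_differentiable_at)
    then show ?thesis
      by (simp only: deriv_cdivide_right K' H_def diff_divide_distrib[of _ "K z"] rearrange)
  qed
  show ?thesis
  proof (rule that[OF S(1,2) _ S(4) real])
    show "0 \<in> S"
      using S(3) \<open>\<bar>ln \<rho>\<bar> > 0\<close> by auto
    fix k and w :: complex
    assume w: "norm (of_real lp * w) < \<bar>ln \<rho>\<bar>"
    have "(\<lambda>n. Delta0_exp_coeff (\<i> * of_real lp) (schwarzschild_beta c \<gamma>) k x n * w ^ n) sums
       ((\<i> * w) ^ k / fact k * (- 1 / (\<i> * of_real lp)\<^sup>2 * (K (- \<i> * (\<i> * of_real lp) * w) / (of_real c)\<^sup>2)))"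
    proof (rule Delta0_exp_series[OF U(1,2) _ _ E _ _ D'])
      show "\<i> * complex_of_real lp \<noteq> 0" using \<open>lp \<noteq> 0\<close> by simp
      show "H holomorphic_on ball 0 \<bar>ln \<rho>\<bar>"
        unfolding H_def[abs_def] using ne S(3) by (auto intro!: holomorphic_intros)
      show "(\<lambda>z. K z / (of_real c)\<^sup>2) holomorphic_on ball 0 \<bar>ln \<rho>\<bar>"
        unfolding divide_inverse by (intro holomorphic_intros KB)
      show "K 0 / (of_real c)\<^sup>2 = 0" using S(5) by simp
      show "norm (\<i> * complex_of_real lp * w) < \<bar>ln \<rho>\<bar>" using w by (simp add: norm_mult)
    qed
    also have "- 1 / (\<i> * of_real lp)\<^sup>2 * (K (- \<i> * (\<i> * of_real lp) * w) / (of_real c)\<^sup>2) =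
        K (of_real lp * w) / of_real (c\<^sup>2 * lp\<^sup>2)"
    proof -
      have "- \<i> * (\<i> * of_real lp) * w = of_real lp * w"
        by (simp flip: mult.assoc)
      moreover have "(\<i> * complex_of_real lp)\<^sup>2 = - (of_real lp)\<^sup>2"
        by (simp add: power_mult_distrib)
      ultimately show ?thesis by (simp add: mult.commute)
    qed
    finally show "(\<lambda>n. Delta0_exp_coeff (\<i> * of_real lp) (schwarzschild_beta c \<gamma>) k x n * w ^ n) sums
       ((\<i> * w) ^ k / fact k * (K (of_real lp * w) / of_real (c\<^sup>2 * lp\<^sup>2)))" .
  qed
qed

lemma wave_coeff_eq:
  assumes "x \<noteq> 0"
  shows "fps_nth (fps_const (\<lambda>y. of_real (1 / c\<^sup>2 * Dfun \<gamma> lp \<omega> (norm y))) * exp_it \<omega>) k x =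
    (\<i> * of_real \<omega>) ^ k / fact k * (of_real (wave_profile (\<gamma> / norm x) (\<omega> * lp)) / of_real (c\<^sup>2 * lp\<^sup>2))"
  using assms by (simp add: exp_it_def Dfun_eq_wave_profile mult_ac)

text \<open>The domain of continuation in the \<open>\<omega>\<close>-plane is the preimage of the half plane under multiplication by \<open>\<lambda>\<^sub>p\<close>; by
convexity it contains the segment from 0 to every \<open>\<omega>\<close> that it contains.\<close>
lemma Delta0_exp_schwarzschild:
  assumes "\<gamma> > 0" "lp \<noteq> 0" "x \<noteq> 0" "norm x \<noteq> \<gamma>" "log_arg \<gamma> lp \<omega> (norm x) > 0"
  shows "Delta0_exp_eq_at (\<i> * of_real lp) (schwarzschild_beta c \<gamma>) \<omega>
           (fps_const (\<lambda>y. of_real (1 / c\<^sup>2 * Dfun \<gamma> lp \<omega> (norm y))) * exp_it \<omega>) x"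
proof -
  define \<rho> where "\<rho> = \<gamma> / norm x"
  have \<rho>: "\<bar>ln \<rho>\<bar> > 0"
    using assms by (simp add: \<rho>_def)
  obtain S K where S: "open S" "convex S" "0 \<in> S" "K holomorphic_on S"
    and real: "\<And>u. (exp u - \<rho>) / (1 - \<rho>) > 0 \<Longrightarrow> of_real u \<in> S \<and> K (of_real u) = of_real (wave_profile \<rho> u)"
    and series: "\<And>k w. norm (of_real lp * w) < \<bar>ln \<rho>\<bar> \<Longrightarrow>
       (\<lambda>n. Delta0_exp_coeff (\<i> * of_real lp) (schwarzschild_beta c \<gamma>) k x n * w ^ n) sums
       ((\<i> * w) ^ k / fact k * (K (of_real lp * w) / of_real (c\<^sup>2 * lp\<^sup>2)))"
    by (rule Delta0_exp_schwarzschild_series[OF assms(1-4), of c, folded \<rho>_def]) blast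
  define W where "W = (\<lambda>w. of_real lp * w) -` S"
  have lin: "linear (\<lambda>w. complex_of_real lp * w)"
    by (simp add: linear_times)
  have "open W"
    unfolding W_def by (intro open_vimage S continuous_intros)
  moreover have "convex W"
    unfolding W_def by (intro convex_linear_vimage lin S)
  ultimately have W: "open W" "convex W" .
  have u: "of_real (\<omega> * lp) \<in> S" "K (of_real (\<omega> * lp)) = of_real (wave_profile \<rho> (\<omega> * lp))"
    using real[of "\<omega> * lp"] assms by (simp_all add: log_arg_eq \<rho>_def)
  have "0 \<in> W" "of_real \<omega> \<in> W"
    using S(3) u(1) by (simp_all add: W_def mult.commute)
  have "\<forall>\<^sub>F w in nhds 0. w \<in> (\<lambda>w. of_real lp * w) -` ball (0::complex) \<bar>ln \<rho>\<bar>"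
    using \<rho> by (intro eventually_nhds_in_open open_vimage continuous_intros) auto
  then have ev: "\<forall>\<^sub>F w in nhds 0. norm (complex_of_real lp * w) < \<bar>ln \<rho>\<bar>"
    by simp
  show ?thesis
    unfolding Delta0_exp_eq_at_def has_continued_sum_def
  proof (intro allI exI conjI)
    fix k
    let ?G = "\<lambda>w. (\<i> * w) ^ k / fact k * (K (of_real lp * w) / of_real (c\<^sup>2 * lp\<^sup>2))"
    show "open W" "connected W" "closed_segment 0 (of_real \<omega>) \<subseteq> W"
      using W \<open>0 \<in> W\<close> \<open>of_real \<omega> \<in> W\<close> by (simp_all add: convex_connected closed_segment_subset)
    have "(K \<circ> (\<lambda>w. of_real lp * w)) holomorphic_on W"
      using S(4) by (intro holomorphic_on_compose_gen[of _ _ _ S] holomorphic_intros) (auto simp: W_def)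
    then show "?G holomorphic_on W"
      unfolding o_def divide_inverse by (intro holomorphic_intros)
    show "\<forall>\<^sub>F w in nhds 0. (\<lambda>n. Delta0_exp_coeff (\<i> * of_real lp) (schwarzschild_beta c \<gamma>) k x n * w ^ n) sums ?G w"
      using ev by eventually_elim (rule series)
    show "?G (of_real \<omega>) = fps_nth (fps_const (\<lambda>y. of_real (1 / c\<^sup>2 * Dfun \<gamma> lp \<omega> (norm y))) * exp_it \<omega>) k x"
      unfolding wave_coeff_eq[OF \<open>x \<noteq> 0\<close>] using u(2) by (simp add: \<rho>_def mult.commute)
  qed
qed

lemma Delta0_exp_schwarzschild_sums:
  assumes "\<gamma> > 0" "lp \<noteq> 0" "x \<noteq> 0" "norm x \<noteq> \<gamma>" "\<bar>\<omega> * lp\<bar> < \<bar>ln (norm x / \<gamma>)\<bar>"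
  shows "(\<lambda>n. (\<i> * of_real \<omega>) ^ n / fact n *
              poly.coeff (Delta0 (\<i> * of_real lp) (schwarzschild_beta c \<gamma>)
                            (npow (\<i> * of_real lp) tgen n)) k x)
          sums fps_nth (fps_const (\<lambda>y. of_real (1 / c\<^sup>2 * Dfun \<gamma> lp \<omega> (norm y))) * exp_it \<omega>) k x"
proof -
  define \<rho> where "\<rho> = \<gamma> / norm x"
  have "ln (norm x / \<gamma>) = - ln \<rho>"
    using assms by (simp add: \<rho>_def ln_div)
  then have small: "\<bar>\<omega> * lp\<bar> < \<bar>ln \<rho>\<bar>"
    using assms(5) by simp
  obtain S K where
    real: "\<And>u. (exp u - \<rho>) / (1 - \<rho>) > 0 \<Longrightarrow> of_real u \<in> S \<and> K (of_real u) = of_real (wave_profile \<rho> u)"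
    and series: "\<And>k w. norm (of_real lp * w) < \<bar>ln \<rho>\<bar> \<Longrightarrow>
       (\<lambda>n. Delta0_exp_coeff (\<i> * of_real lp) (schwarzschild_beta c \<gamma>) k x n * w ^ n) sums
       ((\<i> * w) ^ k / fact k * (K (of_real lp * w) / of_real (c\<^sup>2 * lp\<^sup>2)))"
    by (rule Delta0_exp_schwarzschild_series[OF assms(1-4), of c, folded \<rho>_def]) blast
  have "\<rho> > 0"
    using assms by (simp add: \<rho>_def)
  then have "(exp (\<omega> * lp) - \<rho>) / (1 - \<rho>) > 0"
    using small by (rule log_arg_pos_of_small)
  then have "K (of_real lp * of_real \<omega>) = of_real (wave_profile \<rho> (\<omega> * lp))"
    using real[of "\<omega> * lp"] by (simp add: mult.commute)
  moreover have "norm (of_real lp * complex_of_real \<omega>) < \<bar>ln \<rho>\<bar>"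
    using small by (simp add: norm_mult abs_mult mult.commute)
  ultimately show ?thesis
    using series[of "of_real \<omega>" k] unfolding wave_coeff_eq[OF \<open>x \<noteq> 0\<close>]
    by (simp add: Delta0_exp_coeff_def \<rho>_def power_mult_distrib mult_ac)
qed

section \<open>Limits of the profile\<close>

text \<open>The profile \<open>f\<close> vanishes at 0; the equation \<open>f' = e\<^sup>u (e\<^sup>u - 1) / (e\<^sup>u - \<rho>) - f\<close> gives \<open>f'(0) = 0\<close> and
\<open>f''(0) = 1 / (1 - \<rho>)\<close>. L'Hopital's rule is applied twice.\<close>
lemma tendsto_wave_profile_div_square:
  assumes "\<rho> > 0" "\<rho> \<noteq> 1"
  shows "((\<lambda>u. wave_profile \<rho> u / u\<^sup>2) \<longlongrightarrow> 1 / (2 * (1 - \<rho>))) (at 0)"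
proof -
  define f' where "f' u = exp u * (exp u - 1) / (exp u - \<rho>) - wave_profile \<rho> u" for u
  define f'' where "f'' u = ((exp u * (exp u - 1) + exp u * exp u) * (exp u - \<rho>) - exp u * (exp u - 1) * exp u) /
      ((exp u - \<rho>) * (exp u - \<rho>)) - f' u" for u
  have pos: "\<forall>\<^sub>F u in at 0. (exp u - \<rho>) / (1 - \<rho>) > 0"
    using assms by (intro order_tendstoD(1)[of _ 1]) (auto intro!: tendsto_eq_intros)
  have D: "(wave_profile \<rho> has_real_derivative f' u) (at u)" if "(exp u - \<rho>) / (1 - \<rho>) > 0" for u
  proof -
    have nz: "exp u - \<rho> \<noteq> 0" "1 - \<rho> \<noteq> 0"
      using that by auto
    have ln: "((\<lambda>u. ln ((exp u - \<rho>) / (1 - \<rho>))) has_real_derivative exp u / (exp u - \<rho>)) (at u)"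
      using that nz by (auto intro!: derivative_eq_intros simp: divide_simps)
    have "((\<lambda>u. sinh u + exp (- u) * (1 - \<rho>) * (1 - exp u - \<rho> * g u)) has_real_derivative
        cosh u - exp (- u) * (1 - \<rho>) * (1 - exp u - \<rho> * g u) + exp (- u) * (1 - \<rho>) * (- exp u - \<rho> * l)) (at u)"
      if "(g has_real_derivative l) (at u)" for g l
      by (auto intro!: derivative_eq_intros that simp: algebra_simps)
    note this[OF ln]
    also have "cosh u - exp (- u) * (1 - \<rho>) * (1 - exp u - \<rho> * ln ((exp u - \<rho>) / (1 - \<rho>)))
        + exp (- u) * (1 - \<rho>) * (- exp u - \<rho> * (exp u / (exp u - \<rho>))) = f' u"
      using nz(1) by (simp add: f'_def wave_profile_def sinh_field_def cosh_field_def exp_minus divide_simps)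
        (simp add: algebra_simps)
    finally show ?thesis
      unfolding wave_profile_def[abs_def] .
  qed
  have D2: "(f' has_real_derivative f'' u) (at u)" if "(exp u - \<rho>) / (1 - \<rho>) > 0" for u
  proof -
    have nz: "exp u - \<rho> \<noteq> 0"
      using that by auto
    have "((\<lambda>u. exp u * (exp u - 1) / (exp u - \<rho>) - wave_profile \<rho> u) has_real_derivative f'' u) (at u)"
      using nz by (auto intro!: derivative_eq_intros D that simp: f''_def algebra_simps)
    then show ?thesis
      unfolding f'_def[abs_def] .
  qed
  have at0: "(exp 0 - \<rho>) / (1 - \<rho>) > 0"
    using assms by simp
  have w0: "(wave_profile \<rho> \<longlongrightarrow> 0) (at 0)"
    using DERIV_isCont[OF D[OF at0]] assms by (simp add: isCont_def wave_profile_def)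
  have f0: "(f' \<longlongrightarrow> 0) (at 0)"
    using DERIV_isCont[OF D2[OF at0]] assms by (simp add: isCont_def wave_profile_def f'_def)
  have "(f'' \<longlongrightarrow> 1 / (1 - \<rho>)) (at 0)"
    unfolding f''_def using f0 assms
    by (auto intro!: tendsto_eq_intros simp: power2_eq_square)
  then have "((\<lambda>u. f'' u / 2) \<longlongrightarrow> 1 / (2 * (1 - \<rho>))) (at 0)"
    using assms by (auto intro!: tendsto_eq_intros)
  then have "((\<lambda>u. f' u / (2 * u)) \<longlongrightarrow> 1 / (2 * (1 - \<rho>))) (at 0)"
    by (rule lhopital[rotated -1])
       (use f0 pos in \<open>auto intro!: tendsto_eq_intros derivative_eq_intros simp: eventually_at_filter elim: eventually_mono intro: D2\<close>)
  then show ?thesis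
    by (rule lhopital[rotated -1])
       (use w0 pos in \<open>auto intro!: tendsto_eq_intros derivative_eq_intros simp: eventually_at_filter elim: eventually_mono intro: D\<close>)
qed

text \<open>For \<open>\<omega> \<noteq> 0\<close> one has \<open>D = \<omega>\<^sup>2 (wave_profile \<rho> u / u\<^sup>2)\<close> with \<open>u = \<omega> \<lambda>\<^sub>p\<close>, and \<open>u\<close> tends to 0.\<close>
lemma Dfun_tendsto_commutative:
  assumes "\<gamma> > 0" "r > 0" "r \<noteq> \<gamma>"
  shows "((\<lambda>l. Dfun \<gamma> l \<omega> r) \<longlongrightarrow> \<omega>\<^sup>2 / (2 * (1 - \<gamma> / r))) (at 0)"
proof (cases "\<omega> = 0")
  case True
  then have "Dfun \<gamma> l \<omega> r = 0" for l
    using assms by (simp add: Dfun_def log_arg_def)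
  then show ?thesis
    using True by simp
next
  case False
  define \<rho> where "\<rho> = \<gamma> / r"
  have \<rho>: "\<rho> > 0" "\<rho> \<noteq> 1"
    using assms by (auto simp: \<rho>_def)
  have "filterlim (\<lambda>l. \<omega> * l) (at 0) (at 0)"
    using False by (auto simp: filterlim_at eventually_at_filter intro!: tendsto_eq_intros)
  then have "((\<lambda>l. wave_profile \<rho> (\<omega> * l) / (\<omega> * l)\<^sup>2) \<longlongrightarrow> 1 / (2 * (1 - \<rho>))) (at 0)"
    by (rule filterlim_compose[OF tendsto_wave_profile_div_square[OF \<rho>]])
  then have "((\<lambda>l. \<omega>\<^sup>2 * (wave_profile \<rho> (\<omega> * l) / (\<omega> * l)\<^sup>2)) \<longlongrightarrow> \<omega>\<^sup>2 * (1 / (2 * (1 - \<rho>)))) (at 0)"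
    by (rule tendsto_mult_left)
  then show ?thesis
    using False assms by (simp add: Dfun_eq_wave_profile \<rho>_def power_mult_distrib)
qed

lemma Dfun_tendsto_flat:
  "((\<lambda>r. Dfun \<gamma> lp \<omega> r) \<longlongrightarrow> (cosh (\<omega> * lp) - 1) / lp\<^sup>2) at_top"
proof -
  define u where "u = \<omega> * lp"
  have \<rho>: "((\<lambda>r. \<gamma> / r) \<longlongrightarrow> 0) at_top"
    by (intro tendsto_divide_0[OF tendsto_const] filterlim_at_top_imp_at_infinity filterlim_ident)
  have "((\<lambda>r. wave_profile (\<gamma> / r) u) \<longlongrightarrow> sinh u + exp (- u) * (1 - 0) * (1 - exp u - 0 * ln ((exp u - 0) / (1 - 0)))) at_top"
    unfolding wave_profile_def by (intro tendsto_intros \<rho>) auto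
  also have "sinh u + exp (- u) * (1 - 0) * (1 - exp u - 0 * ln ((exp u - 0) / (1 - 0))) = cosh u - 1"
    by (simp add: sinh_field_def cosh_field_def exp_minus field_simps)
  finally have "((\<lambda>r. wave_profile (\<gamma> / r) u / lp\<^sup>2) \<longlongrightarrow> (cosh u - 1) / lp\<^sup>2) at_top"
    unfolding divide_inverse by (rule tendsto_mult_right)
  moreover have "\<forall>\<^sub>F r in at_top. wave_profile (\<gamma> / r) u / lp\<^sup>2 = Dfun \<gamma> lp \<omega> r"
    using eventually_gt_at_top[of 0] by eventually_elim (simp add: Dfun_eq_wave_profile u_def)
  ultimately show ?thesis
    unfolding u_def[symmetric] by (rule Lim_transform_eventually)
qed

text \<open>The limit is two-sided because \<open>ln (- x) = ln x\<close> for the logarithm on the reals, which is defined through the absolute value.\<close>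
lemma tendsto_mult_ln: "((\<lambda>x::real. x * ln x) \<longlongrightarrow> 0) (at 0)"
proof -
  have inv: "inverse x * ln (inverse x) = - (ln x / x)" for x :: real
    by (simp add: ln_inverse divide_inverse)
  have "((\<lambda>x::real. - (ln x / x)) \<longlongrightarrow> - 0) at_top"
    by (intro tendsto_minus ln_x_over_x_tendsto_0)
  then have right: "((\<lambda>x::real. x * ln x) \<longlongrightarrow> 0) (at_right 0)"
    unfolding filterlim_at_right_to_top by (simp only: inv minus_zero)
  then have "((\<lambda>x::real. - (x * ln x)) \<longlongrightarrow> - 0) (at_right 0)"
    by (rule tendsto_minus)
  then have "((\<lambda>x::real. x * ln x) \<longlongrightarrow> 0) (at_left 0)"
    unfolding filterlim_at_left_to_right by (simp add: ln_minus)
  with right show ?thesis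
    by (simp add: filterlim_at_split)
qed

text \<open>The logarithm in \<open>D\<close> diverges like \<open>ln (r - \<gamma>)\<close> if \<open>\<omega> \<lambda>\<^sub>p \<noteq> 0\<close>, but its factor \<open>1 - \<gamma> / r\<close> vanishes to first
order, so that only the term \<open>sinh\<close> survives.\<close>
lemma Dfun_tendsto_horizon:
  assumes "\<gamma> > 0"
  shows "((\<lambda>r. Dfun \<gamma> lp \<omega> r) \<longlongrightarrow> sinh (\<omega> * lp) / lp\<^sup>2)
            (at \<gamma> within {r. r > 0 \<and> log_arg \<gamma> lp \<omega> r > 0})"
proof -
  define u where "u = \<omega> * lp"
  define F where "F = at \<gamma> within {r. r > 0 \<and> log_arg \<gamma> lp \<omega> r > 0}"
  have F: "F \<le> at \<gamma>"
    unfolding F_def by (rule at_le) simp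
  have id: "((\<lambda>r. r) \<longlongrightarrow> \<gamma>) F"
    unfolding F_def by (rule tendsto_ident_at)
  have evF: "\<forall>\<^sub>F r in F. r > 0 \<and> r \<noteq> \<gamma> \<and> log_arg \<gamma> lp \<omega> r > 0"
    unfolding F_def by (auto simp: eventually_at_filter)
  have *: "((\<lambda>r. (r - \<gamma>) * ln (log_arg \<gamma> lp \<omega> r)) \<longlongrightarrow> 0) F"
  proof (cases "u = 0")
    case True
    then have "\<forall>\<^sub>F r in F. 0 = (r - \<gamma>) * ln (log_arg \<gamma> lp \<omega> r)"
      by (intro eventually_mono[OF evF]) (auto simp: log_arg_def u_def)
    then show ?thesis
      by (rule Lim_transform_eventually[OF tendsto_const])
  next
    case False
    have "filterlim (\<lambda>r. r - \<gamma>) (at 0) (at \<gamma>)"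
      by (auto simp: filterlim_at eventually_at_filter intro!: tendsto_eq_intros)
    then have "filterlim (\<lambda>r. r - \<gamma>) (at 0) F"
      using F by (rule filterlim_mono[OF _ order_refl])
    then have "((\<lambda>r. (r - \<gamma>) * ln (r - \<gamma>)) \<longlongrightarrow> 0) F"
      by (rule filterlim_compose[OF tendsto_mult_ln])
    moreover have "((\<lambda>r. (r - \<gamma>) * ln (exp u * r - \<gamma>)) \<longlongrightarrow> (\<gamma> - \<gamma>) * ln (exp u * \<gamma> - \<gamma>)) F"
      using False assms by (intro tendsto_intros id) auto
    ultimately have "((\<lambda>r. (r - \<gamma>) * ln (exp u * r - \<gamma>) - (r - \<gamma>) * ln (r - \<gamma>)) \<longlongrightarrow>
        (\<gamma> - \<gamma>) * ln (exp u * \<gamma> - \<gamma>) - 0) F"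
      by (rule tendsto_diff[rotated])
    then have "((\<lambda>r. (r - \<gamma>) * ln (exp u * r - \<gamma>) - (r - \<gamma>) * ln (r - \<gamma>)) \<longlongrightarrow> 0) F"
      by simp
    moreover have "\<forall>\<^sub>F r in F. (r - \<gamma>) * ln (exp u * r - \<gamma>) - (r - \<gamma>) * ln (r - \<gamma>) =
                      (r - \<gamma>) * ln (log_arg \<gamma> lp \<omega> r)"
      using evF
    proof eventually_elim
      case (elim r)
      then have "exp u * r - \<gamma> \<noteq> 0"
        by (auto simp: log_arg_def u_def)
      then have "ln (log_arg \<gamma> lp \<omega> r) = ln (exp u * r - \<gamma>) - ln (r - \<gamma>)"
        using elim \<open>exp u * r - \<gamma> \<noteq> 0\<close> by (simp add: ln_div log_arg_def u_def)
      then show ?case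
        by (simp add: right_diff_distrib)
    qed
    ultimately show ?thesis
      by (rule Lim_transform_eventually)
  qed
  have "((\<lambda>r. 1 / lp\<^sup>2 * (sinh u + exp (- u) * ((1 - \<gamma> / r) * (1 - exp u) -
            \<gamma> / r * (1 / r) * ((r - \<gamma>) * ln (log_arg \<gamma> lp \<omega> r))))) \<longlongrightarrow>
          1 / lp\<^sup>2 * (sinh u + exp (- u) * ((1 - \<gamma> / \<gamma>) * (1 - exp u) - \<gamma> / \<gamma> * (1 / \<gamma>) * 0))) F"
    using assms by (intro tendsto_intros id *) auto
  then have "((\<lambda>r. 1 / lp\<^sup>2 * (sinh u + exp (- u) * ((1 - \<gamma> / r) * (1 - exp u) -
            \<gamma> / r * (1 / r) * ((r - \<gamma>) * ln (log_arg \<gamma> lp \<omega> r))))) \<longlongrightarrow> sinh u / lp\<^sup>2) F"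
    using assms by simp
  moreover have "\<forall>\<^sub>F r in F. 1 / lp\<^sup>2 * (sinh u + exp (- u) * ((1 - \<gamma> / r) * (1 - exp u) -
            \<gamma> / r * (1 / r) * ((r - \<gamma>) * ln (log_arg \<gamma> lp \<omega> r)))) = Dfun \<gamma> lp \<omega> r"
    using evF
  proof eventually_elim
    case (elim r)
    have "1 / r * (r - \<gamma>) = 1 - \<gamma> / r"
      using elim by (simp add: diff_divide_distrib)
    then have "\<gamma> / r * (1 / r) * ((r - \<gamma>) * ln (log_arg \<gamma> lp \<omega> r)) =
          (1 - \<gamma> / r) * (\<gamma> / r * ln (log_arg \<gamma> lp \<omega> r))"
      by (metis mult.assoc mult.commute)
    then show ?case
      by (simp only: Dfun_def u_def right_diff_distrib[of "1 - \<gamma> / r" "1 - exp (\<omega> * lp)"] mult.assoc)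
  qed
  ultimately show ?thesis
    unfolding F_def[symmetric] u_def[symmetric] by (rule Lim_transform_eventually)
qed

theorem proposition5p3:
  fixes c \<gamma> lp :: real
  assumes "\<gamma> > 0" and "c > 0" and "lp \<noteq> 0"
  shows
    "(\<forall>\<omega> x. x \<noteq> 0 \<longrightarrow> norm x \<noteq> \<gamma> \<longrightarrow> log_arg \<gamma> lp \<omega> (norm x) > 0 \<longrightarrow>
        Delta0_exp_eq_at (\<i> * of_real lp) (schwarzschild_beta c \<gamma>) \<omega>
          (fps_const (\<lambda>y. of_real (1 / c\<^sup>2 * Dfun \<gamma> lp \<omega> (norm y))) * exp_it \<omega>) x) \<and>
     (\<forall>\<omega> x k. x \<noteq> 0 \<longrightarrow> norm x \<noteq> \<gamma> \<longrightarrow> \<bar>\<omega> * lp\<bar> < \<bar>ln (norm x / \<gamma>)\<bar> \<longrightarrow>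
        (\<lambda>n. (\<i> * of_real \<omega>) ^ n / fact n *
              poly.coeff (Delta0 (\<i> * of_real lp) (schwarzschild_beta c \<gamma>)
                            (npow (\<i> * of_real lp) tgen n)) k x)
          sums fps_nth (fps_const (\<lambda>y. of_real (1 / c\<^sup>2 * Dfun \<gamma> lp \<omega> (norm y))) * exp_it \<omega>) k x) \<and>
     (\<forall>\<omega> r. r > 0 \<longrightarrow> r \<noteq> \<gamma> \<longrightarrow>
        ((\<lambda>l. Dfun \<gamma> l \<omega> r) \<longlongrightarrow> \<omega>\<^sup>2 / (2 * (1 - \<gamma> / r))) (at 0)) \<and>
     (\<forall>\<omega>. ((\<lambda>r. Dfun \<gamma> lp \<omega> r) \<longlongrightarrow> (cosh (\<omega> * lp) - 1) / lp\<^sup>2) at_top) \<and>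
     (\<forall>\<omega>. ((\<lambda>r. Dfun \<gamma> lp \<omega> r) \<longlongrightarrow> sinh (\<omega> * lp) / lp\<^sup>2)
            (at \<gamma> within {r. r > 0 \<and> log_arg \<gamma> lp \<omega> r > 0}))"
proof (intro conjI allI impI)
qed (rule Delta0_exp_schwarzschild Delta0_exp_schwarzschild_sums Dfun_tendsto_commutative
          Dfun_tendsto_flat Dfun_tendsto_horizon; (rule assms | assumption)?)+

end
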